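(* Let $k \ge 1$ and $\theta = 2\pi/(4k+3)$. For every $\varepsilon > 0$ there exist a finite point set $P$ in general position and $u, w \in P$ such that the shortest path between $u$ and $w$ in the $\theta_{4k+3}$-graph on $P$ has length at least $(L - \varepsilon)|uw|$, where $$L = \frac{3\cos(\theta/4) + \cos(3\theta/4) + \sin(\theta/2) + \sin\theta + \sin(3\theta/2)}{3\cos(\theta/2) + \cos(3\theta/2)}.$$ That is, the worst-case spanning ratio of $\theta_{4k+3}$-graphs is at least $L$.
   Context: Cones: for $m \ge 2$, $\theta = 2\pi/m$; around each point $u$ draw $m$ rays with consecutive angular separation $\theta$, oriented so the vertical upward ray from $u$ bisects a cone $C_0^u$; cones numbered clockwise, same orientation at every point. General position: no two points on a line parallel to a cone boundary ray, no two on a line perpendicular to a cone bisector, no three collinear. The $\theta_m$-graph on $P$: for each $u\in P$ and each cone $C_i^u$ containing another point of $P$, add an edge from $u$ to the point of $C_i^u$ whose orthogonal projection onto the bisector of $C_i^u$ is closest to $u$; edges weighted by Euclidean length. *)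

theory Defs
  imports Complex_Main
begin

text \<open>Points of the plane are pairs (x, y) of reals. Angles of directions are
measured clockwise from the vertical upward direction: the direction with
angle a is the unit vector (sin a, cos a).\<close>

type_synonym pt = "real \<times> real"

definition edist :: "pt \<Rightarrow> pt \<Rightarrow> real" where
  "edist p q = sqrt ((fst p - fst q)^2 + (snd p - snd q)^2)"

definition cone_angle :: "nat \<Rightarrow> real" where
  "cone_angle m = 2 * pi / real m"

definition in_cone :: "nat \<Rightarrow> nat \<Rightarrow> pt \<Rightarrow> pt \<Rightarrow> bool" where
  "in_cone m i u v \<longleftrightarrow>
     (\<exists>r>0. \<exists>a. real i * cone_angle m - cone_angle m / 2 \<le> a \<and>
                 a < real i * cone_angle m + cone_angle m / 2 \<and>
                 v = (fst u + r * sin a, snd u + r * cos a))"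

definition bisector_proj :: "nat \<Rightarrow> nat \<Rightarrow> pt \<Rightarrow> pt \<Rightarrow> real" where
  "bisector_proj m i u v =
     (fst v - fst u) * sin (real i * cone_angle m) + (snd v - snd u) * cos (real i * cone_angle m)"

definition theta_edge :: "nat \<Rightarrow> pt set \<Rightarrow> pt \<Rightarrow> pt \<Rightarrow> bool" where
  "theta_edge m P u v \<longleftrightarrow> u \<in> P \<and> v \<in> P \<and>
     (\<exists>i<m. in_cone m i u v \<and>
        (\<forall>w\<in>P. in_cone m i u w \<longrightarrow> bisector_proj m i u v \<le> bisector_proj m i u w))"

definition theta_adj :: "nat \<Rightarrow> pt set \<Rightarrow> pt \<Rightarrow> pt \<Rightarrow> bool" where
  "theta_adj m P u v \<longleftrightarrow> theta_edge m P u v \<or> theta_edge m P v u"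

definition theta_path :: "nat \<Rightarrow> pt set \<Rightarrow> pt list \<Rightarrow> pt \<Rightarrow> pt \<Rightarrow> bool" where
  "theta_path m P ps u w \<longleftrightarrow> ps \<noteq> [] \<and> set ps \<subseteq> P \<and> hd ps = u \<and> last ps = w \<and>
     (\<forall>j. j + 1 < length ps \<longrightarrow> theta_adj m P (ps ! j) (ps ! (j + 1)))"

definition path_length :: "pt list \<Rightarrow> real" where
  "path_length ps = (\<Sum>j<length ps - 1. edist (ps ! j) (ps ! (j + 1)))"

definition general_position :: "nat \<Rightarrow> pt set \<Rightarrow> bool" where
  "general_position m P \<longleftrightarrow>
     (\<forall>p\<in>P. \<forall>q\<in>P. p \<noteq> q \<longrightarrow> (\<forall>i<m.
        \<comment> \<open>not on a line parallel to a cone boundary ray (angle i*theta + theta/2)\<close>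
        (fst q - fst p) * cos (real i * cone_angle m + cone_angle m / 2)
          - (snd q - snd p) * sin (real i * cone_angle m + cone_angle m / 2) \<noteq> 0 \<and>
        \<comment> \<open>not on a line perpendicular to a cone bisector\<close>
        (fst q - fst p) * sin (real i * cone_angle m)
          + (snd q - snd p) * cos (real i * cone_angle m) \<noteq> 0)) \<and>
     (\<forall>p\<in>P. \<forall>q\<in>P. \<forall>r\<in>P. p \<noteq> q \<and> p \<noteq> r \<and> q \<noteq> r \<longrightarrow>
        (fst q - fst p) * (snd r - snd p) - (snd q - snd p) * (fst r - fst p) \<noteq> 0)"

definition lower_bound_L :: "real \<Rightarrow> real" where
  "lower_bound_L t =
     (3 * cos (t / 4) + cos (3 * t / 4) + sin (t / 2) + sin t + sin (3 * t / 2))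
     / (3 * cos (t / 2) + cos (3 * t / 2))"

end

theory Submission
  imports Defs "HOL-Computational_Algebra.Polynomial"
begin

text \<open>Put \<open>u\<close> and \<open>w\<close> on a horizontal line; as \<open>m = 4 k + 3\<close>, each then sees the other at angle
  \<open>\<theta>/4\<close> from a cone bisector, and the set of cones is symmetric under the reflection exchanging
  them. Points in the corners of the triangles that \<open>u\<close> and \<open>w\<close> span destroy the edge \<open>u w\<close>; the
  shortest remaining paths use an edge whose ends again see each other at angle \<open>\<theta>/4\<close> from a
  bisector, so the construction can be repeated. Three rounds give a set of 18 points, degenerate
  in the limit, in which \<open>u\<close> and \<open>w\<close> have graph distance \<open>L\<close>. The lower bound on the length of a
  path is certified by a potential: every pair of points either is blocked from both sides or
  has a potential difference of at most its distance. Coordinates and potentials are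
  polynomials in \<open>T = tan (\<theta>/4)\<close> and \<open>1 / cos (\<theta>/4)\<close>, so finitely many polynomial inequalities on
  \<open>0 < T \<le> 4/17\<close> settle all \<open>k\<close> at once. A shift of order \<open>\<delta>\<close> makes all blocking
  conditions strict, and a further generic shift of order \<open>\<delta>\<^sup>2\<close> achieves general position.\<close>

section \<open>Integer polynomials in the tangent\<close>

fun pev :: "int list \<Rightarrow> real \<Rightarrow> real" where
  "pev [] x = 0"
| "pev (a # p) x = of_int a + x * pev p x"

fun padd :: "int list \<Rightarrow> int list \<Rightarrow> int list" where
  "padd [] q = q"
| "padd (a # p) [] = a # p"
| "padd (a # p) (b # q) = (a + b) # padd p q"

definition psmult :: "int \<Rightarrow> int list \<Rightarrow> int list" where
  "psmult c p = map (\<lambda>a. c * a) p"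

fun pmult :: "int list \<Rightarrow> int list \<Rightarrow> int list" where
  "pmult [] q = []"
| "pmult (a # p) q = padd (psmult a q) (0 # pmult p q)"

definition psub :: "int list \<Rightarrow> int list \<Rightarrow> int list" where
  "psub p q = padd p (psmult (-1) q)"

lemma pev_padd [simp]: "pev (padd p q) x = pev p x + pev q x"
  by (induction p q rule: padd.induct) (simp_all add: distrib_left)

lemma pev_psmult [simp]: "pev (psmult c p) x = of_int c * pev p x"
  by (induction p) (auto simp: psmult_def algebra_simps)

lemma pev_pmult [simp]: "pev (pmult p q) x = pev p x * pev q x"
  by (induction p) (auto simp: algebra_simps)

lemma pev_psub [simp]: "pev (psub p q) x = pev p x - pev q x"
  by (simp add: psub_def)

text \<open>A Horner scheme for a lower bound on \<open>[0, 4/17]\<close>; rounding down keeps the bound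
  an integer.\<close>

fun plow :: "int list \<Rightarrow> int" where
  "plow [] = 0"
| "plow (a # p) = a + (4 * min 0 (plow p)) div 17"

text \<open>On this interval the tail \<open>x * pev p x\<close> is smallest at 0 if the bound for
  \<open>pev p x\<close> is nonnegative, and at least 4/17 times that bound otherwise.\<close>

lemma plow_le:
  assumes "0 \<le> x" "x \<le> 4/17"
  shows "of_int (plow p) \<le> pev p x"
proof (induction p)
  case (Cons a p)
  define l where "l = real_of_int (min 0 (plow p))"
  have l: "l \<le> 0" "l \<le> pev p x" using Cons by (auto simp: l_def)
  have "real_of_int ((4 * min 0 (plow p)) div 17) \<le> 4/17 * l"
    using real_of_int_div4[of "4 * min 0 (plow p)" 17] by (simp add: l_def)
  also have "\<dots> \<le> x * l"
    using assms l by (intro mult_right_mono_neg) auto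
  also have "\<dots> \<le> x * pev p x" using assms l by (intro mult_left_mono) auto
  finally show ?case by simp
qed simp

text \<open>The factor 64 absorbs the rounding errors of \<^const>\<open>plow\<close>.\<close>

fun ppos :: "int list \<Rightarrow> bool" where
  "ppos [] = False"
| "ppos (a # p) = (if a = 0 then ppos p else 0 < plow (psmult 64 (a # p)))"

lemma ppos_pev:
  assumes "0 < x" "x \<le> 4/17"
  shows "ppos p \<Longrightarrow> 0 < pev p x"
proof (induction p)
  case (Cons a p)
  show ?case
  proof (cases "a = 0")
    case False
    then have "0 < plow (psmult 64 (a # p))" using Cons.prems by simp
    then have "0 < real_of_int (plow (psmult 64 (a # p)))" by (simp only: of_int_0_less_iff)
    also have "\<dots> \<le> pev (psmult 64 (a # p)) x"
      using assms by (intro plow_le) auto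
    finally show ?thesis unfolding pev_psmult by simp
  qed (use Cons assms in simp)
qed simp

definition pzero :: "int list \<Rightarrow> bool" where
  "pzero p = list_all (\<lambda>a. a = 0) p"

lemma pzero_pev: "pzero p \<Longrightarrow> pev p x = 0"
  by (induction p) (auto simp: pzero_def)

text \<open>De Moivre: the imaginary and real parts of (1 + i T)^n as polynomials in T.\<close>

fun ptrig :: "nat \<Rightarrow> int list \<times> int list" where
  "ptrig 0 = ([], [1])"
| "ptrig (Suc n) = (case ptrig n of (s, c) \<Rightarrow> (padd s (0 # c), psub c (0 # s)))"

lemma ptrig:
  assumes "cos t \<noteq> 0"
  shows "ptrig n = (s, c) \<Longrightarrow>
    sin (real n * t) = cos t ^ n * pev s (tan t) \<and> cos (real n * t) = cos t ^ n * pev c (tan t)"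
proof (induction n arbitrary: s c)
  case (Suc n)
  obtain s' c' where sc: "ptrig n = (s', c')" by fastforce
  have e: "real (Suc n) * t = real n * t + t" by (simp add: algebra_simps)
  have "cos t * tan t = sin t" using assms by (simp add: tan_def)
  then show ?case
    using Suc.IH[OF sc] Suc.prems sc unfolding e sin_add cos_add
    by (auto simp: algebra_simps)
qed auto

text \<open>The vector \<open>(s, c)\<close> points, up to the factor \<open>cos t ^ \<bar>j\<bar>\<close>, in the direction
  \<open>q \<cdot> \<pi>/2 + j t\<close>.\<close>

fun pdir :: "nat \<Rightarrow> int \<Rightarrow> int list \<times> int list" where
  "pdir 0 j = (case ptrig (nat \<bar>j\<bar>) of (s, c) \<Rightarrow> (if j < 0 then psmult (-1) s else s, c))"
| "pdir (Suc q) j = (case pdir q j of (s, c) \<Rightarrow> (c, psmult (-1) s))"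

lemma pdir:
  assumes "cos t \<noteq> 0"
  shows "pdir q j = (s, c) \<Longrightarrow>
    sin (real q * (pi/2) + of_int j * t) = cos t ^ nat \<bar>j\<bar> * pev s (tan t) \<and>
    cos (real q * (pi/2) + of_int j * t) = cos t ^ nat \<bar>j\<bar> * pev c (tan t)"
proof (induction q arbitrary: s c)
  case 0
  obtain s' c' where sc: "ptrig (nat \<bar>j\<bar>) = (s', c')" by fastforce
  have "of_int j * t = (if j < 0 then - (real (nat \<bar>j\<bar>) * t) else real (nat \<bar>j\<bar>) * t)"
    by simp
  then show ?case using ptrig[OF assms sc] 0 sc by (cases "j < 0") (auto simp: minus_equation_iff)
next
  case (Suc q)
  obtain s' c' where sc: "pdir q j = (s', c')" by fastforce
  have e: "real (Suc q) * (pi/2) + of_int j * t = (real q * (pi/2) + of_int j * t) + pi/2"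
    by (simp add: algebra_simps add_divide_distrib)
  have "s = c'" "c = psmult (-1) s'" using Suc.prems sc by simp_all
  then show ?case
    using Suc.IH[OF sc] unfolding e sin_add cos_add by simp
qed

section \<open>The configuration\<close>

text \<open>Fix \<open>m = 4 k + 3\<close>, \<open>t = \<theta>/4 = \<pi>/(2 m)\<close> and \<open>T = tan t\<close>. A node \<open>(x, y, dx, dy, a, b)\<close> stands
  for the point \<open>(x(T) + \<delta> dx, y(T) + \<delta> dy)\<close> with potential \<open>a(T) + b(T) / cos t\<close>.\<close>

type_synonym node = "int list \<times> int list \<times> int \<times> int \<times> int list \<times> int list"

definition mirror :: "node \<Rightarrow> node" where
  "mirror = (\<lambda>(x, y, dx, dy, a, b). (psmult (-1) x, y, -dx, dy, psmult (-1) a, psmult (-1) b))"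

text \<open>Scaled so that \<open>w - u = (1, 0)\<close>, with \<open>C = cos t / cos 2t\<close>, \<open>D = sin 3t / cos 2t\<close>,
  \<open>B = sin t / cos 2t\<close> and \<open>l = D B sin t / sin 4t\<close>, the first nine limit points are

  \<^item> 0: \<open>w\<close>
  \<^item> 1 and 8: \<open>u + C (cos 3t, - sin 3t)\<close>, the lower corner of the triangle of \<open>u\<close> through \<open>w\<close>
  \<^item> 2 and 3: \<open>w + (D B, 0)\<close> and \<open>w - (0, D C)\<close>, blocking the edge between 1 and \<open>w\<close>
  \<^item> 4 and 5: \<open>w + l (cos 3t, sin 3t)\<close> and \<open>w + (D B, 0) + l (- cos 3t, sin 3t)\<close>, blocking
    the edge between 2 and \<open>w\<close>
  \<^item> 6 and 7: (node 1)\<open> + l (cos 5t, - sin 5t)\<close> and (node 3)\<open> - l (cos t, sin t)\<close>, blocking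
    the edge between 1 and 3.

  Nodes 1 and 8 are separated only by \<open>\<delta>\<close> and lie on different sides of a cone boundary of
  \<open>u\<close>; node 8 keeps \<open>u\<close> from being joined to 6. The mirror images are numbered 9 to 17, so \<open>u\<close>
  is node 9. The data are multiplied by \<open>K = 8 (1 + T\<^sup>2) (1 - T\<^sup>2)\<^sup>3\<close>, which clears all denominators,
  the origin is the midpoint of \<open>u w\<close>, and the potential is twice the distance from \<open>u\<close> minus its
  mean value.\<close>

definition nodes :: "node list" where
  "nodes = (let h =
  [
   ([4, 0, -8, 0, 0, 0, 8, 0, -4],
    [], 0, 0,
    [0, 24, 0, -8, 0, -24, 0, 8],
    [8, 0, 16, 0, 8]),
   ([4, 0, -32, 0, 56, 0, -32, 0, 4],
    [0, -24, 0, 56, 0, -40, 0, 8], 0, 1,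
    [0, -24, 0, 8, 0, 24, 0, -8],
    [8, 0, -32, 0, -24, 0, 16]),
   ([4, 0, 16, 0, -8, 0, -16, 0, 4],
    [], -3, -1,
    [0, 24, 0, -8, 0, -24, 0, 8],
    [8, 0, -32, 0, -24, 0, 16]),
   ([4, 0, -8, 0, 0, 0, 8, 0, -4],
    [0, -24, 0, 8, 0, 24, 0, -8], -1, 2,
    [0, -24, 0, 8, 0, 24, 0, -8],
    [8, 0, 16, 0, 8]),
   ([4, 0, -2, 0, -14, 0, -6, 0, 2],
    [0, 0, 0, 18, 0, 6, 0, -10, 0, 2], 0, -3,
    [0, 24, 0, -8, 0, -24, 0, 8],
    [8, 0, 4, 0, -12, 0, -4, 0, 4]),
   ([4, 0, 10, 0, 6, 0, -2, 0, -2],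
    [0, 0, 0, 18, 0, 6, 0, -10, 0, 2], 0, -1,
    [0, 24, 0, -8, 0, -24, 0, 8],
    [8, 0, -20, 0, -4, 0, 20, 0, -4]),
   ([4, 0, -26, 0, -6, 0, 18, 0, -6],
    [0, -24, 0, 26, 0, 30, 0, -18, 0, 2], 0, 3,
    [0, -24, 0, 8, 0, 24, 0, -8],
    [8, 0, -20, 0, -4, 0, 20, 0, -4]),
   ([4, 0, -14, 0, -10, 0, 6, 0, -2],
    [0, -24, 0, 2, 0, 14, 0, -10, 0, 2], 0, 2,
    [0, -24, 0, 8, 0, 24, 0, -8],
    [8, 0, 4, 0, -12, 0, -4, 0, 4]),
   ([4, 0, -32, 0, 56, 0, -32, 0, 4],
    [0, -24, 0, 56, 0, -40, 0, 8], 0, -1,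
    [0, -24, 0, 8, 0, 24, 0, -8],
    [8, 0, -32, 0, -24, 0, 16])]
  in h @ map mirror h)"

text \<open>Positivity, for small \<open>\<delta> > 0\<close>, of the component of \<open>n' - n\<close> in direction \<open>(s, c)\<close>,
  an affine function of \<open>\<delta>\<close>.\<close>

definition ahead :: "int list \<times> int list \<Rightarrow> node \<Rightarrow> node \<Rightarrow> bool" where
  "ahead = (\<lambda>(s, c) (x, y, dx, dy, _) (x', y', dx', dy', _).
     let f = padd (pmult s (psub x' x)) (pmult c (psub y' y))
     in if pzero f then ppos (padd (psmult (dx' - dx) s) (psmult (dy' - dy) c)) else ppos f)"

text \<open>\<open>(q, j)\<close> denotes the cone with bisector angle \<open>q \<cdot> \<pi>/2 + j t\<close>; its index is \<open>(q m + j) / 4\<close>,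
  an integer since \<open>m \<equiv> 3 (mod 4)\<close>. The inward normals of its boundary rays have angles
  \<open>(q + 1) \<cdot> \<pi>/2 + (j - 2) t\<close> and \<open>(q - 1) \<cdot> \<pi>/2 + (j + 2) t\<close>.\<close>

definition blocks :: "nat \<times> int \<Rightarrow> node \<Rightarrow> node \<Rightarrow> node \<Rightarrow> bool" where
  "blocks = (\<lambda>(q, j) z u v.
     q < 4 \<and> (3 * int q + j) mod 4 = 0 \<and> \<bar>j\<bar> < 7 \<and> (q = 0 \<longrightarrow> 0 \<le> j) \<and>
     ahead (pdir (q + 1) (j - 2)) u v \<and> ahead (pdir (q + 3) (j + 2)) u v \<and>
     ahead (pdir (q + 1) (j - 2)) u z \<and> ahead (pdir (q + 3) (j + 2)) u z \<and>
     ahead (pdir q j) z v)"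

text \<open>The potential difference \<open>f + g h\<close> with \<open>h = 1 / cos t\<close> is at most twice the distance iff
  \<open>e h \<le> d\<close>. As \<open>1 \<le> h \<le> 1 + T\<^sup>2/2\<close>, it suffices to test the two ends of this interval.\<close>

definition far :: "node \<Rightarrow> node \<Rightarrow> bool" where
  "far = (\<lambda>(x, y, _, _, a, b) (x', y', _, _, a', b').
     let u = psub x' x; v = psub y' y; f = psub a' a; g = psub b' b;
         d = psub (psmult 4 (padd (pmult u u) (pmult v v)))
               (padd (pmult f f) (pmult [1, 0, 1] (pmult g g)));
         e = psmult 2 (pmult f g); d1 = psub d e; d2 = psub (psmult 2 d) (pmult [2, 0, 1] e)
     in (pzero d1 \<or> ppos d1) \<and> (pzero d2 \<or> ppos d2))"

text \<open>An entry \<open>((u, v), c, z, c', z')\<close> says that \<open>z\<close> is closer to \<open>u\<close> than \<open>v\<close> in the cone \<open>c\<close>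
  of \<open>u\<close>, and \<open>z'\<close> is closer to \<open>v\<close> than \<open>u\<close> in the cone \<open>c'\<close> of \<open>v\<close>.\<close>

definition certs :: "((nat \<times> nat) \<times> (nat \<times> int) \<times> nat \<times> (nat \<times> int) \<times> nat) list" where
  "certs =
  [((1, 0), (0, 0), 2, (2, 2), 3), ((2, 0), (3, -1), 4, (1, 1), 5), ((3, 1), (3, 3), 6, (1, 1), 7),
   ((4, 1), (2, 2), 3, (0, 0), 0), ((5, 1), (2, 2), 3, (0, 0), 0), ((6, 0), (0, 0), 2, (2, 2), 1),
   ((6, 4), (0, 0), 0, (2, 2), 1), ((7, 0), (0, 0), 2, (2, 2), 1), ((8, 0), (0, 0), 1, (2, 2), 1),
   ((8, 3), (1, 1), 7, (3, 3), 6), ((8, 4), (0, 0), 0, (2, 2), 1), ((8, 5), (0, 0), 0, (2, 2), 1),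
   ((9, 0), (1, 1), 1, (3, -1), 10), ((9, 2), (1, 1), 0, (3, -1), 0), ((9, 3), (1, 1), 0, (3, 3), 1),
   ((9, 4), (1, 1), 0, (3, -1), 0), ((9, 5), (1, 1), 0, (3, -1), 0), ((9, 6), (1, 5), 8, (3, 3), 1),
   ((10, 9), (0, 0), 11, (2, -2), 12), ((11, 0), (1, 1), 1, (3, -1), 9), ((11, 2), (1, 1), 0, (3, -1), 0),
   ((11, 4), (1, 1), 0, (3, -1), 0), ((11, 5), (1, 1), 0, (3, -1), 0), ((11, 9), (1, 1), 13, (3, -1), 14),
   ((12, 0), (1, -3), 10, (3, -1), 9), ((12, 10), (1, -3), 15, (3, -1), 16), ((13, 0), (1, 1), 1, (3, -1), 9),
   ((13, 2), (1, 1), 0, (3, -1), 0), ((13, 4), (1, 1), 0, (3, -1), 0), ((13, 5), (1, 1), 0, (3, -1), 0),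
   ((13, 10), (2, -2), 12, (0, 0), 9), ((14, 0), (1, 1), 1, (3, -1), 9), ((14, 2), (1, 1), 0, (3, -1), 0),
   ((14, 4), (1, 1), 0, (3, -1), 0), ((14, 5), (1, 1), 0, (3, -1), 0), ((14, 10), (2, -2), 12, (0, 0), 9),
   ((15, 0), (1, -3), 10, (3, -5), 17), ((15, 9), (0, 0), 11, (2, -2), 10), ((15, 13), (0, 0), 9, (2, -2), 10),
   ((16, 9), (0, 0), 11, (2, -2), 10), ((17, 9), (0, 0), 10, (2, -2), 10), ((17, 12), (3, -1), 16, (1, -3), 15),
   ((17, 13), (0, 0), 9, (2, -2), 10), ((17, 14), (0, 0), 9, (2, -2), 10)]"

text \<open>The finite verification for all \<open>k\<close> at once. Unordered pairs suffice, since
  a certificate blocks the edge from both ends and distance is symmetric.\<close>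

lemma nodes_checked:
  "list_all (\<lambda>u. list_all (\<lambda>v. case map_of certs (u, v) of
       None \<Rightarrow> far (nodes ! u) (nodes ! v)
     | Some (c, z, c', z') \<Rightarrow> z < 18 \<and> z' < 18 \<and>
         blocks c (nodes ! z) (nodes ! u) (nodes ! v) \<and>
         blocks c' (nodes ! z') (nodes ! v) (nodes ! u)) [0..<u]) [0..<18]"
  by code_simp

section \<open>Cones, edges and paths\<close>

definition prog :: "real \<Rightarrow> pt \<Rightarrow> pt \<Rightarrow> real" where
  "prog \<beta> u v = (fst v - fst u) * sin \<beta> + (snd v - snd u) * cos \<beta>"

lemma bisector_proj_prog: "bisector_proj m i u v = prog (real i * cone_angle m) u v"
  by (simp add: bisector_proj_def prog_def)

text \<open>The aperture is below \<pi>, so the interior of the cone is the intersection of two open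
  half-planes; the two hypotheses use their inward normals.\<close>

lemma in_coneI:
  assumes m: "m \<ge> 3"
    and 1: "prog (real i * cone_angle m + (pi/2 - cone_angle m / 2)) u v > 0"
    and 2: "prog (real i * cone_angle m - (pi/2 - cone_angle m / 2)) u v > 0"
  shows "in_cone m i u v"
proof -
  define \<beta> \<gamma> where "\<beta> = real i * cone_angle m" and "\<gamma> = cone_angle m / 2"
  have "\<gamma> \<le> pi / 3" "0 < \<gamma>"
    using m by (auto simp: \<gamma>_def cone_angle_def field_simps)
  then have \<gamma>: "0 < \<gamma>" "\<gamma> < pi/2" using pi_gt_zero by linarith+
  have cg: "cos \<gamma> > 0" using \<gamma> by (intro cos_gt_zero_pi) auto
  \<comment> \<open>Coordinates of \<open>v - u\<close> along the bisector and perpendicular to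
    it.\<close>
  define a where "a = prog \<beta> u v"
  define e where "e = prog (\<beta> + pi/2) u v"
  have "prog (\<beta> + (pi/2 - \<gamma>)) u v = e * cos \<gamma> + a * sin \<gamma>"
    "prog (\<beta> - (pi/2 - \<gamma>)) u v = - e * cos \<gamma> + a * sin \<gamma>"
    by (simp_all add: prog_def a_def e_def sin_add cos_add sin_diff cos_diff algebra_simps)
  then have b: "e * cos \<gamma> + a * sin \<gamma> > 0" "- e * cos \<gamma> + a * sin \<gamma> > 0"
    using 1 2 by (simp_all add: \<beta>_def \<gamma>_def)
  then have "a * sin \<gamma> > 0" by linarith
  moreover have "sin \<gamma> > 0" using \<gamma> by (intro sin_gt_zero) auto
  ultimately have a: "a > 0" by (simp add: zero_less_mult_iff)
  define r where "r = sqrt (a^2 + e^2)"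
  have r: "r > 0" using a by (simp add: r_def add_pos_nonneg)
  define \<phi> where "\<phi> = arctan (e / a)"
  have sq: "sqrt (1 + (e/a)^2) = r / a"
  proof -
    have "1 + (e/a)^2 = (a^2 + e^2) / a^2" using a by (simp add: field_simps power2_eq_square)
    then show ?thesis using a by (simp add: r_def real_sqrt_divide)
  qed
  have sc: "sin \<phi> = e / r" "cos \<phi> = a / r"
    using a r by (simp_all add: \<phi>_def sin_arctan cos_arctan sq)
  have "e / a < tan \<gamma>" "- tan \<gamma> < e / a"
    using b a cg by (simp_all add: tan_def field_simps)
  then have "arctan (e / a) < arctan (tan \<gamma>)" "arctan (tan (- \<gamma>)) < arctan (e / a)"
    by (simp_all only: arctan_less_iff tan_minus)
  moreover have "arctan (tan \<gamma>) = \<gamma>" "arctan (tan (- \<gamma>)) = - \<gamma>"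
    using \<gamma> by (intro arctan_tan; simp)+
  ultimately have "\<phi> < \<gamma>" "- \<gamma> < \<phi>" by (simp_all add: \<phi>_def)
  moreover have "v = (fst u + r * sin (\<beta> + \<phi>), snd u + r * cos (\<beta> + \<phi>))"
  proof -
    have s1: "sin \<beta> * sin \<beta> + cos \<beta> * cos \<beta> = 1" using sin_cos_squared_add[of \<beta>] by (simp add: power2_eq_square)
    have ae: "a = (fst v - fst u) * sin \<beta> + (snd v - snd u) * cos \<beta>"
      "e = (fst v - fst u) * cos \<beta> - (snd v - snd u) * sin \<beta>"
      by (simp_all add: a_def e_def prog_def sin_add cos_add)
    have "r * sin (\<beta> + \<phi>) = a * sin \<beta> + e * cos \<beta>"
      "r * cos (\<beta> + \<phi>) = a * cos \<beta> - e * sin \<beta>"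
      using r by (simp_all add: sin_add cos_add sc field_simps)
    then have "r * sin (\<beta> + \<phi>) = fst v - fst u" "r * cos (\<beta> + \<phi>) = snd v - snd u"
      using s1 unfolding ae by algebra+
    then show ?thesis by (simp add: prod_eq_iff)
  qed
  ultimately show ?thesis
    unfolding in_cone_def \<beta>_def \<gamma>_def using r
    by (intro exI[of _ r] conjI exI[of _ "real i * cone_angle m + \<phi>"]) auto
qed

text \<open>Two angles of one direction differ by a multiple of \<open>m\<close> apertures, and the
  intervals are half-open; hence \<open>m\<close> divides \<open>i - j\<close>.\<close>

lemma in_cone_unique:
  assumes "in_cone m i u v" "in_cone m j u v" "i < m" "j < m"
  shows "i = j"
proof -
  obtain r a where r: "r > 0" and a: "real i * cone_angle m - cone_angle m / 2 \<le> a"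
    "a < real i * cone_angle m + cone_angle m / 2"
    and v: "v = (fst u + r * sin a, snd u + r * cos a)"
    using assms(1) unfolding in_cone_def by blast
  obtain r' a' where r': "r' > 0" and a': "real j * cone_angle m - cone_angle m / 2 \<le> a'"
    "a' < real j * cone_angle m + cone_angle m / 2"
    and v': "v = (fst u + r' * sin a', snd u + r' * cos a')"
    using assms(2) unfolding in_cone_def by blast
  have e: "r * sin a = r' * sin a'" "r * cos a = r' * cos a'" using v v' by auto
  have sq: "(s * sin b)^2 + (s * cos b)^2 = s^2" for s b :: real
    by (simp add: power_mult_distrib flip: distrib_left)
  have "r^2 = r'^2" using sq[of r a] sq[of r' a'] unfolding e by simp
  then have "r = r'" using r r' by (simp add: power2_eq_iff)
  then have "sin a = sin a' \<and> cos a = cos a'" using e r by simp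
  then obtain n :: int where n: "a = a' + 2 * pi * of_int n"
    unfolding sin_cos_eq_iff by auto
  have m: "0 < m" using assms(3) by simp
  define w where "w = cone_angle m"
  have w: "w > 0" using m by (simp add: w_def cone_angle_def)
  have p: "2 * pi = real m * w" using m by (simp add: w_def cone_angle_def)
  define d where "d = int i - int j - int m * n"
  have "of_int d * w = (real i * w - a) - (real j * w - a')"
    using n unfolding p by (simp add: d_def algebra_simps)
  then have "of_int d * w < 1 * w" "(-1) * w < of_int d * w"
    using a a' unfolding w_def[symmetric] by linarith+
  then have "real_of_int d < 1" "-1 < real_of_int d"
    using w by (simp_all only: mult_less_cancel_right_pos)
  then have "d = 0" by linarith
  then have "int i - int j = int m * n" by (simp add: d_def)
  moreover have "\<bar>int i - int j\<bar> < int m" using assms(3,4) by linarith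
  ultimately have "int m * \<bar>n\<bar> < int m * 1" by (simp add: abs_mult)
  then have "\<bar>n\<bar> < 1" using m by (simp only: mult_less_cancel_left_pos of_nat_0_less_iff)
  then have "n = 0" by simp
  then show ?thesis using \<open>int i - int j = int m * n\<close> by simp
qed

lemma not_theta_edge:
  assumes "i < m" "in_cone m i u v" "in_cone m i u w" "w \<in> P"
    "bisector_proj m i u w < bisector_proj m i u v"
  shows "\<not> theta_edge m P u v"
proof
  assume "theta_edge m P u v"
  then obtain j where j: "j < m" "in_cone m j u v"
    "\<forall>w\<in>P. in_cone m j u w \<longrightarrow> bisector_proj m j u v \<le> bisector_proj m j u w"
    unfolding theta_edge_def by blast
  then have "j = i" using in_cone_unique assms by blast
  then show False using j assms by force
qed

text \<open>Weak duality for shortest paths: the potential difference telescopes along the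
  path.\<close>

lemma path_length_ge_potential:
  assumes path: "theta_path m P ps u w"
    and step: "\<And>x y. x \<in> P \<Longrightarrow> y \<in> P \<Longrightarrow> theta_adj m P x y \<Longrightarrow> \<bar>f x - f y\<bar> \<le> c * edist x y"
  shows "f w - f u \<le> c * path_length ps"
proof -
  define n where "n = length ps - 1"
  have ps: "ps \<noteq> []" "hd ps = u" "last ps = w" "set ps \<subseteq> P"
    using path by (auto simp: theta_path_def)
  then have "f w - f u = f (ps ! n) - f (ps ! 0)"
    by (simp add: n_def last_conv_nth hd_conv_nth)
  also have "\<dots> = (\<Sum>j<n. f (ps ! Suc j) - f (ps ! j))"
    by (rule sum_lessThan_telescope[symmetric])
  also have "\<dots> \<le> (\<Sum>j<n. c * edist (ps ! j) (ps ! (j + 1)))"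
  proof (rule sum_mono)
    fix j assume "j \<in> {..<n}"
    then have j: "j + 1 < length ps" by (simp add: n_def)
    then have "ps ! j \<in> set ps" "ps ! (j + 1) \<in> set ps" by simp_all
    then have "ps ! j \<in> P" "ps ! (j + 1) \<in> P" using ps(4) by blast+
    moreover have "theta_adj m P (ps ! j) (ps ! (j + 1))"
      using path j by (auto simp: theta_path_def)
    ultimately show "f (ps ! Suc j) - f (ps ! j) \<le> c * edist (ps ! j) (ps ! (j + 1))"
      using step[of "ps ! j" "ps ! (j + 1)"] by simp
  qed
  finally show ?thesis by (simp add: path_length_def n_def sum_distrib_left)
qed

section \<open>Generic perturbation\<close>

lemma exists_off_lines:
  fixes F :: "(real \<times> real \<times> real) set"
  assumes "finite F" "\<And>a b c. (a, b, c) \<in> F \<Longrightarrow> (a, b) \<noteq> (0, 0)" "r > 0"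
  shows "\<exists>p :: pt. \<bar>fst p - x\<bar> < r \<and> \<bar>snd p - y\<bar> < r \<and>
    (\<forall>(a, b, c) \<in> F. a * fst p + b * snd p \<noteq> c)"
proof -
  \<comment> \<open>a line meets the parabola \<open>s \<mapsto> (x + s, y + s\<^sup>2)\<close> at most twice\<close>
  define Q where "Q = (\<lambda>(a, b, c). [:a * x + b * y - c, a, b:])"
  define B where "B = (\<Union>l\<in>F. {s. poly (Q l) s = 0})"
  have "finite B" unfolding B_def
  proof (intro finite_UN_I assms(1) poly_roots_finite)
    fix l assume "l \<in> F"
    then show "Q l \<noteq> 0" using assms(2)[of "fst l" "fst (snd l)" "snd (snd l)"]
      by (auto simp: Q_def split_beta)
  qed
  moreover have "infinite {0<..<min r 1}" using assms(3) by (simp add: infinite_Ioo)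
  ultimately obtain s where s: "0 < s" "s < r" "s < 1" "s \<notin> B"
    by (metis (no_types, lifting) finite_subset greaterThanLessThan_iff min_less_iff_conj subsetI)
  have "a * (x + s) + b * (y + s * s) \<noteq> c" if "(a, b, c) \<in> F" for a b c
  proof -
    have "poly (Q (a, b, c)) s \<noteq> 0" using s(4) that by (auto simp: B_def)
    then show ?thesis by (simp add: Q_def algebra_simps)
  qed
  moreover have "s * s < r" using s mult_strict_mono[of s 1 s r] by simp
  ultimately show ?thesis
    using s by (intro exI[of _ "(x + s, y + s * s)"]) auto
qed

definition aligned :: "nat \<Rightarrow> pt \<Rightarrow> pt \<Rightarrow> bool" where
  "aligned m p q \<longleftrightarrow> (\<exists>i<m.
     (fst q - fst p) * cos (real i * cone_angle m + cone_angle m / 2)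
       - (snd q - snd p) * sin (real i * cone_angle m + cone_angle m / 2) = 0 \<or>
     (fst q - fst p) * sin (real i * cone_angle m)
       + (snd q - snd p) * cos (real i * cone_angle m) = 0)"

definition collinear3 :: "pt \<Rightarrow> pt \<Rightarrow> pt \<Rightarrow> bool" where
  "collinear3 p q r \<longleftrightarrow>
     (fst q - fst p) * (snd r - snd p) - (snd q - snd p) * (fst r - fst p) = 0"

lemma general_position_alt:
  "general_position m P \<longleftrightarrow>
     (\<forall>p\<in>P. \<forall>q\<in>P. p \<noteq> q \<longrightarrow> \<not> aligned m p q) \<and>
     (\<forall>p\<in>P. \<forall>q\<in>P. \<forall>r\<in>P. p \<noteq> q \<and> p \<noteq> r \<and> q \<noteq> r \<longrightarrow> \<not> collinear3 p q r)"
  unfolding general_position_def aligned_def collinear3_def by blast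

lemma aligned_commute: "aligned m p q \<longleftrightarrow> aligned m q p"
proof -
  have "(a - b) * c - (d - e) * f = 0 \<longleftrightarrow> (b - a) * c - (e - d) * f = 0"
    "(a - b) * c + (d - e) * f = 0 \<longleftrightarrow> (b - a) * c + (e - d) * f = 0"
    for a b c d e f :: real by (auto simp: algebra_simps)
  then show ?thesis unfolding aligned_def by metis
qed

lemma collinear3_commute:
  "collinear3 p q r \<longleftrightarrow> collinear3 q p r" "collinear3 p q r \<longleftrightarrow> collinear3 p r q"
  unfolding collinear3_def by (simp_all add: algebra_simps eq_commute)

lemma general_position_insert:
  assumes "general_position m P" "\<And>q. q \<in> P \<Longrightarrow> \<not> aligned m q p"
    "\<And>q r. q \<in> P \<Longrightarrow> r \<in> P \<Longrightarrow> q \<noteq> r \<Longrightarrow> \<not> collinear3 q r p"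
  shows "general_position m (insert p P)"
  unfolding general_position_alt
proof (intro conjI ballI impI)
  fix a b assume "a \<in> insert p P" "b \<in> insert p P" "a \<noteq> b"
  then show "\<not> aligned m a b"
    using assms(1,2) aligned_commute[of m p] unfolding general_position_alt by blast
next
  fix a b c assume abc: "a \<in> insert p P" "b \<in> insert p P" "c \<in> insert p P"
    "a \<noteq> b \<and> a \<noteq> c \<and> b \<noteq> c"
  consider "a = p" | "b = p" | "c = p" | "a \<in> P" "b \<in> P" "c \<in> P" using abc by blast
  then show "\<not> collinear3 a b c"
  proof cases
    case 1
    then show ?thesis using assms(3)[of b c] abc collinear3_commute[of p b c]
        collinear3_commute[of b p c] by blast
  next
    case 2
    then show ?thesis using assms(3)[of a c] abc collinear3_commute[of a p c] by blast
  next
    case 3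
    then show ?thesis using assms(3)[of a b] abc by blast
  next
    case 4
    then show ?thesis using assms(1) abc unfolding general_position_alt by blast
  qed
qed

lemma exists_point_general_position:
  assumes P: "finite P" "general_position m P" and r: "r > 0" and m: "m > 0"
  shows "\<exists>p. \<bar>fst p - x\<bar> < r \<and> \<bar>snd p - y\<bar> < r \<and> p \<notin> P \<and> general_position m (insert p P)"
proof -
  let ?b = "\<lambda>i. real i * cone_angle m + cone_angle m / 2" and ?c = "\<lambda>i. real i * cone_angle m"
  \<comment> \<open>The lines to avoid: through a point of \<open>P\<close> parallel to a boundary
    ray (\<open>F1\<close>) or perpendicular to a bisector (\<open>F2\<close>), and through two
    points of \<open>P\<close> (\<open>F3\<close>).\<close>
  define F1 where "F1 = (\<lambda>(q, i). (cos (?b i), - sin (?b i), fst q * cos (?b i) - snd q * sin (?b i))) ` (P \<times> {..<m})"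
  define F2 where "F2 = (\<lambda>(q, i). (sin (?c i), cos (?c i), fst q * sin (?c i) + snd q * cos (?c i))) ` (P \<times> {..<m})"
  define F3 where "F3 = (\<lambda>(q, s). (- (snd s - snd q), fst s - fst q,
      (fst s - fst q) * snd q - (snd s - snd q) * fst q)) ` (P \<times> P - Id)"
  have sc: "\<not> (sin z = 0 \<and> cos z = 0)" for z :: real
    using sin_cos_squared_add[of z] by (auto simp del: sin_cos_squared_add)
  have "\<exists>p :: pt. \<bar>fst p - x\<bar> < r \<and> \<bar>snd p - y\<bar> < r \<and>
    (\<forall>(a, b, c) \<in> F1 \<union> F2 \<union> F3. a * fst p + b * snd p \<noteq> c)"
  proof (rule exists_off_lines)
    show "finite (F1 \<union> F2 \<union> F3)" using P by (simp add: F1_def F2_def F3_def)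
    show "(a, b) \<noteq> (0, 0)" if "(a, b, c) \<in> F1 \<union> F2 \<union> F3" for a b c
      using that sc by (auto simp: F1_def F2_def F3_def prod_eq_iff)
  qed fact
  then obtain p :: pt where p: "\<bar>fst p - x\<bar> < r" "\<bar>snd p - y\<bar> < r"
    and F: "\<And>a b c. (a, b, c) \<in> F1 \<union> F2 \<union> F3 \<Longrightarrow> a * fst p + b * snd p \<noteq> c" by blast
  have al: "\<not> aligned m q p" if q: "q \<in> P" for q
  proof
    assume "aligned m q p"
    then obtain i where i: "i < m" and
      "(fst p - fst q) * cos (?b i) - (snd p - snd q) * sin (?b i) = 0 \<or>
       (fst p - fst q) * sin (?c i) + (snd p - snd q) * cos (?c i) = 0"
      unfolding aligned_def by blast
    then have "cos (?b i) * fst p + - sin (?b i) * snd p = fst q * cos (?b i) - snd q * sin (?b i) \<or>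
      sin (?c i) * fst p + cos (?c i) * snd p = fst q * sin (?c i) + snd q * cos (?c i)"
      by (auto simp: algebra_simps)
    moreover have
      "(cos (?b i), - sin (?b i), fst q * cos (?b i) - snd q * sin (?b i)) \<in> F1 \<union> F2 \<union> F3"
      "(sin (?c i), cos (?c i), fst q * sin (?c i) + snd q * cos (?c i)) \<in> F1 \<union> F2 \<union> F3"
      using q i by (auto simp: F1_def F2_def)
    ultimately show False using F by blast
  qed
  have "\<not> collinear3 q s p" if qs: "q \<in> P" "s \<in> P" "q \<noteq> s" for q s
  proof
    assume "collinear3 q s p"
    then have "- (snd s - snd q) * fst p + (fst s - fst q) * snd p
        = (fst s - fst q) * snd q - (snd s - snd q) * fst q"
      by (simp add: collinear3_def algebra_simps)
    moreover have "(- (snd s - snd q), fst s - fst q,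
        (fst s - fst q) * snd q - (snd s - snd q) * fst q) \<in> F1 \<union> F2 \<union> F3"
      using qs by (force simp: F3_def)
    ultimately show False using F by blast
  qed
  \<comment> \<open>Every point is aligned with itself, as there is at least one cone.\<close>
  moreover have "p \<notin> P" using al[of p] m by (auto simp: aligned_def)
  ultimately show ?thesis using p al P general_position_insert by blast
qed

lemma exists_perturbation:
  fixes X :: "nat \<Rightarrow> pt"
  assumes "r > 0" "m > 0"
  shows "\<exists>g. (\<forall>k<n. \<bar>fst (g k) - fst (X k)\<bar> < r \<and> \<bar>snd (g k) - snd (X k)\<bar> < r) \<and>
    inj_on g {..<n} \<and> general_position m (g ` {..<n})"
proof (induction n)
  case 0
  then show ?case by (simp add: general_position_alt)
next
  case (Suc n)
  then obtain g where g: "\<And>k. k < n \<Longrightarrow> \<bar>fst (g k) - fst (X k)\<bar> < r \<and> \<bar>snd (g k) - snd (X k)\<bar> < r"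
    "inj_on g {..<n}" "general_position m (g ` {..<n})" by blast
  obtain p where p: "\<bar>fst p - fst (X n)\<bar> < r" "\<bar>snd p - snd (X n)\<bar> < r" "p \<notin> g ` {..<n}"
    "general_position m (insert p (g ` {..<n}))"
    using exists_point_general_position[of "g ` {..<n}" m r "fst (X n)" "snd (X n)"] g assms by auto
  define h where "h = g(n := p)"
  have hg: "h k = g k" if "k < n" for k using that by (simp add: h_def)
  have im: "h ` {..<n} = g ` {..<n}" by (auto simp: hg)
  have "inj_on h {..<n}" using g(2) hg by (auto simp: inj_on_def)
  moreover have "h n = p" by (simp add: h_def)
  ultimately show ?case
    using g(1) p by (intro exI[of _ h]) (auto simp: lessThan_Suc im hg less_Suc_eq)
qed

section \<open>The configuration for small perturbations\<close>

lemma lower_bound_L_alt: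
  "lower_bound_L (4 * t) = (cos t ^ 3 + cos t * cos (2 * t) * sin (3 * t)) / cos (2 * t) ^ 3"
proof -
  have "sin (2 * t) + sin (4 * t) = 2 * sin (3 * t) * cos t"
    using sin_diff[of "3 * t" t] sin_add[of "3 * t" t] by simp
  moreover have "sin (6 * t) = 2 * sin (3 * t) * cos (3 * t)"
    using sin_double[of "3 * t"] by simp
  moreover have "cos (2 * t - t) + cos (2 * t + t) = 2 * cos (2 * t) * cos t"
    unfolding cos_diff cos_add by simp
  then have "cos t + cos (3 * t) = 2 * cos (2 * t) * cos t" by simp
  ultimately have s: "sin (2 * t) + sin (4 * t) + sin (6 * t) = 4 * (cos t * cos (2 * t) * sin (3 * t))"
    by algebra
  have c: "3 * cos x + cos (3 * x) = 4 * cos x ^ 3" for x :: real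
    by (simp add: cos_treble_cos)
  have num: "3 * cos t + cos (3 * t) + sin (2 * t) + sin (4 * t) + sin (6 * t)
      = 4 * (cos t ^ 3 + cos t * cos (2 * t) * sin (3 * t))"
    using s c[of t] by algebra
  have den: "3 * cos (2 * t) + cos (6 * t) = 4 * cos (2 * t) ^ 3"
    using c[of "2 * t"] by simp
  have ang: "4 * t / 4 = t" "3 * (4 * t) / 4 = 3 * t" "4 * t / 2 = 2 * t" "3 * (4 * t) / 2 = 6 * t"
    by simp_all
  show ?thesis unfolding lower_bound_L_def ang num den
    by (rule mult_divide_mult_cancel_left) simp
qed

text \<open>The largest \<open>t\<close> occurs for seven cones; 4/17 is a rational slightly above
  tan(\<pi>/14).\<close>

lemma tan_quarter_bounds:
  assumes "0 < t" "t \<le> pi / 14"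
  shows "cos t > 0" "0 < tan t" "tan t \<le> 4/17"
proof -
  have t: "t < pi / 6" using assms pi_gt_zero by linarith
  show c: "cos t > 0" using assms t pi_gt_zero by (intro cos_gt_zero_pi) linarith+
  then have c0: "cos t \<noteq> 0" by simp
  show T: "0 < tan t" using assms t pi_gt_zero by (intro tan_gt_zero) linarith+
  define x where "x = (tan t)\<^sup>2"
  have "tan t < tan (pi/6)" using assms t pi_gt_zero by (intro tan_monotone) linarith+
  then have "tan t < 1 / sqrt 3" by (simp only: tan_30)
  then have "x < (1 / sqrt 3)\<^sup>2" unfolding x_def using T by (intro power_strict_mono) simp_all
  then have x: "0 < x" "x < 1/3" using T by (simp_all add: x_def power_divide)
  \<comment> \<open>\<open>cos 7t = cos\<^sup>7 t \<cdot> (1 - 21x + 35x\<^sup>2 - 7x\<^sup>3)\<close> is nonnegative\<close>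
  have "ptrig 7 = ([0, 7, 0, -35, 0, 21, 0, -1], [1, 0, -21, 0, 35, 0, -7])" by code_simp
  then have "cos (real 7 * t) = cos t ^ 7 * pev [1, 0, -21, 0, 35, 0, -7] (tan t)"
    using ptrig[OF c0] by blast
  also have "pev [1, 0, -21, 0, 35, 0, -7] (tan t) = 1 - 21 * x + 35 * x\<^sup>2 - 7 * x ^ 3"
    by (simp add: x_def algebra_simps power2_eq_square power3_eq_cube)
  finally have "cos (7 * t) = cos t ^ 7 * (1 - 21 * x + 35 * x\<^sup>2 - 7 * x ^ 3)" by simp
  moreover have "cos (7 * t) \<ge> 0" using assms pi_gt_zero by (intro cos_ge_zero) linarith+
  ultimately have "0 \<le> 1 - 21 * x + 35 * x\<^sup>2 - 7 * x ^ 3" using c by (simp add: zero_le_mult_iff)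
  moreover have "x ^ 3 > 0" using x by simp
  ultimately have p: "0 < 1 - 21 * x + 35 * x\<^sup>2" by linarith
  have "x \<le> (4/17)\<^sup>2"
  proof (rule ccontr)
    assume "\<not> ?thesis"
    then have x': "16/289 < x" by (simp add: power_divide)
    \<comment> \<open>Between 16/289 and 1/3 the square of \<open>x\<close> lies below its chord;
      this turns \<open>p\<close> into a linear inequality that fails there.\<close>
    then have "0 < (x - 16/289) * (1/3 - x)" using x by (intro mult_pos_pos) auto
    also have "\<dots> = 337/867 * x - x\<^sup>2 - 16/867" by (simp add: field_simps power2_eq_square)
    finally show False using p x' by linarith
  qed
  then show "tan t \<le> 4/17" unfolding x_def by (rule power2_le_imp_le) simp
qed

definition loc :: "real \<Rightarrow> real \<Rightarrow> node \<Rightarrow> pt" where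
  "loc T \<delta> = (\<lambda>(x, y, dx, dy, _). (pev x T + \<delta> * of_int dx, pev y T + \<delta> * of_int dy))"

definition pot :: "real \<Rightarrow> node \<Rightarrow> real" where
  "pot t = (\<lambda>(_, _, _, _, a, b). pev a (tan t) + pev b (tan t) / cos t)"

lemma far_pot:
  assumes T: "0 < tan t" "tan t \<le> 4/17" and c: "cos t > 0" and far: "far n n'"
  shows "\<bar>pot t n' - pot t n\<bar> \<le> 2 * edist (loc (tan t) 0 n) (loc (tan t) 0 n')"
proof -
  obtain x y dx dy a b where n: "n = (x, y, dx, dy, a, b)" by (cases n) auto
  obtain x' y' dx' dy' a' b' where n': "n' = (x', y', dx', dy', a', b')" by (cases n') auto
  define T where "T = tan t"
  define h where "h = 1 / cos t"
  define f g where "f = pev a' T - pev a T" and "g = pev b' T - pev b T"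
  define X Y where "X = pev x' T - pev x T" and "Y = pev y' T - pev y T"
  define d e where "d = 4 * (X * X + Y * Y) - (f * f + (1 + T * T) * (g * g))" and "e = 2 * (f * g)"
  have nn: "pzero p \<or> ppos p \<Longrightarrow> 0 \<le> pev p T" for p
    using pzero_pev[of p T] ppos_pev[of T p] T by (auto simp: T_def)
  have d1: "e \<le> d" and d2: "(2 + T * T) * e \<le> 2 * d"
    using far unfolding far_def n n' Let_def
    by (auto dest!: nn simp: d_def e_def f_def g_def X_def Y_def algebra_simps)
  have h2: "h\<^sup>2 = 1 + T\<^sup>2"
    using c by (simp add: h_def T_def tan_def power_divide sin_squared_eq field_simps)
  have h1: "1 \<le> h" using c by (simp add: h_def)
  have "h\<^sup>2 \<le> (1 + T\<^sup>2 / 2)\<^sup>2" unfolding h2 by (simp add: power2_sum)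
  then have h3: "h \<le> 1 + T\<^sup>2 / 2" by (rule power2_le_imp_le) simp
  have "e * h \<le> d"
  proof (cases "0 \<le> e")
    case True
    then have "e * h \<le> e * (1 + T\<^sup>2 / 2)" using h3 by (intro mult_left_mono)
    then show ?thesis using d2 by (simp add: algebra_simps power2_eq_square)
  next
    case False
    then have "e * h \<le> e * 1" using h1 by (intro mult_left_mono_neg) auto
    then show ?thesis using d1 by simp
  qed
  then have "(f + g * h)\<^sup>2 \<le> (2 * sqrt (X\<^sup>2 + Y\<^sup>2))\<^sup>2"
    using h2 by (simp add: d_def e_def power2_sum power_mult_distrib power2_eq_square algebra_simps)
  then have "\<bar>f + g * h\<bar> \<le> 2 * sqrt (X\<^sup>2 + Y\<^sup>2)"
    by (metis abs_le_square_iff abs_of_nonneg mult_nonneg_nonneg real_sqrt_ge_zero zero_le_numeral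
        sum_power2_ge_zero)
  moreover have "pot t n' - pot t n = f + g * h"
    by (simp add: pot_def n n' f_def g_def h_def T_def algebra_simps diff_divide_distrib)
  moreover have "edist (loc (tan t) 0 n) (loc (tan t) 0 n') = sqrt (X\<^sup>2 + Y\<^sup>2)"
    by (simp add: edist_def loc_def n n' X_def Y_def T_def power2_commute)
  ultimately show ?thesis by simp
qed

text \<open>A quadratic error is dominated by the constant term or, if that vanishes, by the linear
  one.\<close>

lemma eventually_lex_pos:
  fixes a b M :: real
  assumes "0 < a \<or> (a = 0 \<and> 0 < b)"
  shows "\<forall>\<^sub>F \<delta> in at_right 0. M * \<delta>\<^sup>2 < a + \<delta> * b"
proof -
  have "\<forall>\<^sub>F \<delta> in at_right 0. 0 < a + \<delta> * b - M * \<delta>\<^sup>2"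
  proof (cases "0 < a")
    case True
    have "((\<lambda>\<delta>. a + \<delta> * b - M * \<delta>\<^sup>2) \<longlongrightarrow> a + 0 * b - M * 0\<^sup>2) (at_right 0)"
      by (intro tendsto_intros)
    then show ?thesis using True by (intro order_tendstoD(1)) auto
  next
    case False
    have "((\<lambda>\<delta>. b - M * \<delta>) \<longlongrightarrow> b - M * 0) (at_right 0)"
      by (intro tendsto_intros)
    then have "\<forall>\<^sub>F \<delta> in at_right 0. 0 < b - M * \<delta>"
      using assms False by (intro order_tendstoD(1)) auto
    moreover have "\<forall>\<^sub>F \<delta> in at_right 0. (0::real) < \<delta>"
      by (simp add: eventually_at_right_less)
    ultimately show ?thesis
    proof eventually_elim
      case (elim \<delta>)
      then have "0 < \<delta> * (b - M * \<delta>)" by simp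
      then show ?case using assms False by (simp add: algebra_simps power2_eq_square)
    qed
  qed
  then show ?thesis by eventually_elim simp
qed

text \<open>The arbitrary error of size \<open>\<delta>\<^sup>2\<close> leaves room for reaching general position.\<close>

definition near :: "real \<Rightarrow> pt \<Rightarrow> pt \<Rightarrow> bool" where
  "near \<delta> p q \<longleftrightarrow> \<bar>fst p - fst q\<bar> < \<delta>\<^sup>2 \<and> \<bar>snd p - snd q\<bar> < \<delta>\<^sup>2"

lemma ahead_eventually:
  assumes T: "0 < T" "T \<le> 4/17" and ahead: "ahead (s, c) n n'"
    and p: "\<forall>\<^sub>F \<delta> in at_right 0. near \<delta> (p \<delta>) (loc T \<delta> n)"
    and p': "\<forall>\<^sub>F \<delta> in at_right 0. near \<delta> (p' \<delta>) (loc T \<delta> n')"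
  shows "\<forall>\<^sub>F \<delta> in at_right 0.
    0 < (fst (p' \<delta>) - fst (p \<delta>)) * pev s T + (snd (p' \<delta>) - snd (p \<delta>)) * pev c T"
proof -
  obtain x y dx dy a b where n: "n = (x, y, dx, dy, a, b)" by (cases n) auto
  obtain x' y' dx' dy' a' b' where n': "n' = (x', y', dx', dy', a', b')" by (cases n') auto
  define S C where "S = pev s T" and "C = pev c T"
  define A where "A = S * (pev x' T - pev x T) + C * (pev y' T - pev y T)"
  define B where "B = S * of_int (dx' - dx) + C * of_int (dy' - dy)"
  have "0 < A \<or> (A = 0 \<and> 0 < B)"
    using ahead ppos_pev[OF T] pzero_pev[of _ T]
    unfolding ahead_def n n' Let_def A_def B_def S_def C_def
    by (fastforce split: if_splits simp: algebra_simps)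
  then have "\<forall>\<^sub>F \<delta> in at_right 0. (2 * \<bar>S\<bar> + 2 * \<bar>C\<bar>) * \<delta>\<^sup>2 < A + \<delta> * B"
    by (rule eventually_lex_pos)
  then show ?thesis using p p'
  proof eventually_elim
    case (elim \<delta>)
    define u v where "u = (fst (p' \<delta>) - fst (p \<delta>)) - (fst (loc T \<delta> n') - fst (loc T \<delta> n))"
      and "v = (snd (p' \<delta>) - snd (p \<delta>)) - (snd (loc T \<delta> n') - snd (loc T \<delta> n))"
    have uv: "\<bar>u\<bar> \<le> 2 * \<delta>\<^sup>2" "\<bar>v\<bar> \<le> 2 * \<delta>\<^sup>2"
      using elim(2,3) unfolding near_def u_def v_def by linarith+
    have "\<bar>S * u\<bar> \<le> \<bar>S\<bar> * (2 * \<delta>\<^sup>2)" "\<bar>C * v\<bar> \<le> \<bar>C\<bar> * (2 * \<delta>\<^sup>2)"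
      using uv by (auto simp: abs_mult intro!: mult_left_mono)
    moreover have "(fst (p' \<delta>) - fst (p \<delta>)) * S + (snd (p' \<delta>) - snd (p \<delta>)) * C
        = A + \<delta> * B + S * u + C * v"
      by (simp add: A_def B_def u_def v_def loc_def n n' algebra_simps)
    ultimately show ?case using elim(1) unfolding S_def C_def by (simp add: algebra_simps)
  qed
qed

lemma blocks_eventually:
  assumes m: "m = 4 * k + 3" "t = pi / (2 * real m)"
    and T: "0 < tan t" "tan t \<le> 4/17" and c: "cos t > 0" and blocks: "blocks (q, j) nz nu nv"
    and u: "\<forall>\<^sub>F \<delta> in at_right 0. near \<delta> (u \<delta>) (loc (tan t) \<delta> nu)"
    and v: "\<forall>\<^sub>F \<delta> in at_right 0. near \<delta> (v \<delta>) (loc (tan t) \<delta> nv)"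
    and z: "\<forall>\<^sub>F \<delta> in at_right 0. near \<delta> (z \<delta>) (loc (tan t) \<delta> nz)"
    and P: "\<forall>\<^sub>F \<delta> in at_right 0. z \<delta> \<in> P \<delta>"
    and k: "1 \<le> k"
  shows "\<forall>\<^sub>F \<delta> in at_right 0. \<not> theta_edge m (P \<delta>) (u \<delta>) (v \<delta>)"
proof -
  have bl: "ahead (pdir (q + 1) (j - 2)) nu nv" "ahead (pdir (q + 3) (j + 2)) nu nv"
    "ahead (pdir (q + 1) (j - 2)) nu nz" "ahead (pdir (q + 3) (j + 2)) nu nz"
    "ahead (pdir q j) nz nv"
    using blocks unfolding blocks_def prod.case by blast+
  have q: "q < 4" "(3 * int q + j) mod 4 = 0" "\<bar>j\<bar> < 7" "q = 0 \<Longrightarrow> 0 \<le> j"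
    using blocks by (auto simp: blocks_def)
  define i where "i = nat ((int q * int m + j) div 4)"
  have "int q * int m + j = (3 * int q + j) + 4 * (int k * int q)" by (simp add: m algebra_simps)
  then have "(int q * int m + j) mod 4 = 0" using q(2) by (metis mod_mult_self2)
  then have d: "4 * ((int q * int m + j) div 4) = int q * int m + j" by (simp add: mod_0_imp_dvd)
  have bnds: "0 \<le> int q * int m + j" "int q * int m + j < 4 * int m"
  proof -
    have "q = 0 \<or> q = 1 \<or> q = 2 \<or> q = 3" using q(1) by linarith
    moreover have "7 \<le> int m" using m k by simp
    ultimately show "0 \<le> int q * int m + j" "int q * int m + j < 4 * int m"
      using q(3,4) by auto
  qed
  then have i4: "4 * int i = int q * int m + j" and im: "i < m"
    using d unfolding i_def by linarith+
  have mp: "real m > 0" "m \<ge> 3" using m by auto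
  have th: "cone_angle m = 4 * t" by (simp add: cone_angle_def m(2))
  have "real_of_int (4 * int i) = real_of_int (int q * int m + j)" using i4 by simp
  then have "real i * 4 = real q * real m + of_int j" by simp
  then have "(real i * 4) * t = (real q * real m + of_int j) * t" by simp
  moreover have mt: "real m * t = pi / 2" using mp m(2) by simp
  ultimately have ang: "real i * cone_angle m = real q * (pi/2) + of_int j * t"
    unfolding th by (simp add: algebra_simps)
  have prog: "\<forall>\<^sub>F \<delta> in at_right 0. 0 < prog (real q' * (pi/2) + of_int j' * t) (p \<delta>) (p' \<delta>)"
    if "ahead (pdir q' j') n n'"
      "\<forall>\<^sub>F \<delta> in at_right 0. near \<delta> (p \<delta>) (loc (tan t) \<delta> n)"
      "\<forall>\<^sub>F \<delta> in at_right 0. near \<delta> (p' \<delta>) (loc (tan t) \<delta> n')"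
    for q' j' n n' and p p' :: "real \<Rightarrow> pt"
  proof -
    obtain s e where se: "pdir q' j' = (s, e)" by fastforce
    have "cos t \<noteq> 0" using c by simp
    note tr = pdir[OF this se]
    have "ahead (s, e) n n'" using that(1) by (simp add: se)
    from ahead_eventually[OF T this that(2,3)] show ?thesis
    proof eventually_elim
      case (elim \<delta>)
      have "prog (real q' * (pi/2) + of_int j' * t) (p \<delta>) (p' \<delta>) = cos t ^ nat \<bar>j'\<bar> *
        ((fst (p' \<delta>) - fst (p \<delta>)) * pev s (tan t) + (snd (p' \<delta>) - snd (p \<delta>)) * pev e (tan t))"
        unfolding prog_def tr[THEN conjunct1] tr[THEN conjunct2] by (simp add: algebra_simps)
      then show ?case using elim c by simp
    qed
  qed
  have cone: "\<forall>\<^sub>F \<delta> in at_right 0. in_cone m i (u \<delta>) (p \<delta>)"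
    if p: "\<forall>\<^sub>F \<delta> in at_right 0. near \<delta> (p \<delta>) (loc (tan t) \<delta> n)"
      and n: "ahead (pdir (q + 1) (j - 2)) nu n" "ahead (pdir (q + 3) (j + 2)) nu n"
    for n and p :: "real \<Rightarrow> pt"
    using prog[OF n(1) u p] prog[OF n(2) u p]
  proof eventually_elim
    case (elim \<delta>)
    have a1: "real (q + 1) * (pi/2) + of_int (j - 2) * t = real i * cone_angle m + (pi/2 - cone_angle m / 2)"
      unfolding ang unfolding th by (simp add: algebra_simps add_divide_distrib)
    \<comment> \<open>\<open>q + 3\<close> stands for \<open>q - 1\<close>, which may be negative;
      the cost is a full turn.\<close>
    have a2: "real (q + 3) * (pi/2) + of_int (j + 2) * t
      = (real i * cone_angle m - (pi/2 - cone_angle m / 2)) + 2 * pi"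
      unfolding ang unfolding th by (simp add: algebra_simps add_divide_distrib)
    have per: "prog (\<beta> + 2 * pi) = prog \<beta>" for \<beta> by (simp add: prog_def fun_eq_iff)
    show ?case using elim mp unfolding a1 a2 per by (intro in_coneI) auto
  qed
  have "\<forall>\<^sub>F \<delta> in at_right 0. in_cone m i (u \<delta>) (v \<delta>)"
    "\<forall>\<^sub>F \<delta> in at_right 0. in_cone m i (u \<delta>) (z \<delta>)"
    "\<forall>\<^sub>F \<delta> in at_right 0. 0 < prog (real q * (pi/2) + of_int j * t) (z \<delta>) (v \<delta>)"
    using bl by (blast intro: cone[OF v] cone[OF z] prog[OF _ z v])+
  then show ?thesis using P
  proof eventually_elim
    case (elim \<delta>)
    have "bisector_proj m i (u \<delta>) (z \<delta>) < bisector_proj m i (u \<delta>) (v \<delta>)"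
      using elim(3) unfolding bisector_proj_prog ang by (simp add: prog_def algebra_simps)
    then show ?case using not_theta_edge[OF im] elim by blast
  qed
qed

lemma near_tendsto:
  assumes "\<forall>\<^sub>F \<delta> in at_right 0. near \<delta> (p \<delta>) (loc T \<delta> n)"
  shows "((\<lambda>\<delta>. fst (p \<delta>)) \<longlongrightarrow> fst (loc T 0 n)) (at_right 0)"
    and "((\<lambda>\<delta>. snd (p \<delta>)) \<longlongrightarrow> snd (loc T 0 n)) (at_right 0)"
proof -
  have sq: "(f \<longlongrightarrow> a) (at_right 0)"
    if f: "\<forall>\<^sub>F \<delta> in at_right 0. \<bar>f \<delta> - (a + \<delta> * b)\<bar> < \<delta>\<^sup>2" for f :: "real \<Rightarrow> real" and a b
  proof (rule tendsto_sandwich)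
    show "\<forall>\<^sub>F \<delta> in at_right 0. a + \<delta> * b - \<delta>\<^sup>2 \<le> f \<delta>"
      "\<forall>\<^sub>F \<delta> in at_right 0. f \<delta> \<le> a + \<delta> * b + \<delta>\<^sup>2"
      using f by (eventually_elim; linarith)+
    have "((\<lambda>\<delta>. a + \<delta> * b - \<delta>\<^sup>2) \<longlongrightarrow> a + 0 * b - 0\<^sup>2) (at_right 0)"
      "((\<lambda>\<delta>. a + \<delta> * b + \<delta>\<^sup>2) \<longlongrightarrow> a + 0 * b + 0\<^sup>2) (at_right 0)"
      by (intro tendsto_intros)+
    then show "((\<lambda>\<delta>. a + \<delta> * b - \<delta>\<^sup>2) \<longlongrightarrow> a) (at_right 0)"
      "((\<lambda>\<delta>. a + \<delta> * b + \<delta>\<^sup>2) \<longlongrightarrow> a) (at_right 0)" by simp_all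
  qed
  obtain x y dx dy a b where n: "n = (x, y, dx, dy, a, b)" by (cases n) auto
  show "((\<lambda>\<delta>. fst (p \<delta>)) \<longlongrightarrow> fst (loc T 0 n)) (at_right 0)"
    using assms by (intro sq[where b = "of_int dx"]) (auto simp: near_def loc_def n elim: eventually_mono)
  show "((\<lambda>\<delta>. snd (p \<delta>)) \<longlongrightarrow> snd (loc T 0 n)) (at_right 0)"
    using assms by (intro sq[where b = "of_int dy"]) (auto simp: near_def loc_def n elim: eventually_mono)
qed

lemma near_edist_tendsto:
  assumes "\<forall>\<^sub>F \<delta> in at_right 0. near \<delta> (p \<delta>) (loc T \<delta> n)"
    and "\<forall>\<^sub>F \<delta> in at_right 0. near \<delta> (q \<delta>) (loc T \<delta> n')"
  shows "((\<lambda>\<delta>. edist (p \<delta>) (q \<delta>)) \<longlongrightarrow> edist (loc T 0 n) (loc T 0 n')) (at_right 0)"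
  unfolding edist_def by (intro tendsto_intros near_tendsto assms)

text \<open>The factor \<open>1 + \<eta>\<close> absorbs the perturbation by continuity. Where limit
  points coincide, as for nodes 1 and 8, their potentials agree.\<close>

lemma far_eventually:
  assumes T: "0 < tan t" "tan t \<le> 4/17" and c: "cos t > 0" and far: "far n n'" and \<eta>: "\<eta> > 0"
    and p: "\<forall>\<^sub>F \<delta> in at_right 0. near \<delta> (p \<delta>) (loc (tan t) \<delta> n)"
    and p': "\<forall>\<^sub>F \<delta> in at_right 0. near \<delta> (p' \<delta>) (loc (tan t) \<delta> n')"
  shows "\<forall>\<^sub>F \<delta> in at_right 0. \<bar>pot t n - pot t n'\<bar> \<le> 2 * (1 + \<eta>) * edist (p \<delta>) (p' \<delta>)"
proof -
  let ?d = "edist (loc (tan t) 0 n) (loc (tan t) 0 n')"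
  have le: "\<bar>pot t n - pot t n'\<bar> \<le> 2 * ?d"
    using far_pot[OF T c far] by (simp add: abs_minus_commute)
  have nn: "0 \<le> edist x y" for x y by (simp add: edist_def)
  show ?thesis
  proof (cases "?d = 0")
    case True
    then have "\<bar>pot t n - pot t n'\<bar> \<le> 0" using le by simp
    also have "0 \<le> 2 * (1 + \<eta>) * edist x y" for x y using nn[of x y] \<eta> by simp
    finally show ?thesis by (intro always_eventually allI)
  next
    case False
    then have d: "0 < ?d" using nn[of "loc (tan t) 0 n" "loc (tan t) 0 n'"] by linarith
    have "((\<lambda>\<delta>. (1 + \<eta>) * edist (p \<delta>) (p' \<delta>)) \<longlongrightarrow> (1 + \<eta>) * ?d) (at_right 0)"
      by (rule tendsto_mult[OF tendsto_const near_edist_tendsto[OF p p']])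
    moreover have "?d < (1 + \<eta>) * ?d" using d \<eta> by simp
    ultimately have "\<forall>\<^sub>F \<delta> in at_right 0. ?d < (1 + \<eta>) * edist (p \<delta>) (p' \<delta>)"
      by (rule order_tendstoD(1))
    then show ?thesis by eventually_elim (use le in linarith)
  qed
qed

lemma pot_span:
  assumes c: "cos t > 0" and T: "0 < tan t" "tan t < 1"
  shows "pot t (nodes ! 0) - pot t (nodes ! 9) =
      2 * lower_bound_L (4 * t) * edist (loc (tan t) 0 (nodes ! 9)) (loc (tan t) 0 (nodes ! 0))"
    and "0 < edist (loc (tan t) 0 (nodes ! 9)) (loc (tan t) 0 (nodes ! 0))"
proof -
  define T where "T = tan t"
  \<comment> \<open>This is cos 2t divided by the square of cos t, not the number of cones.\<close>
  define m where "m = 1 - T * T"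
  have m: "m > 0" using T mult_strict_mono[of T 1 T 1] by (simp add: m_def T_def)
  have n0: "nodes ! 0 = ([4, 0, -8, 0, 0, 0, 8, 0, -4], [], 0, 0,
      [0, 24, 0, -8, 0, -24, 0, 8], [8, 0, 16, 0, 8])"
    and n9: "nodes ! 9 = ([-4, 0, 8, 0, 0, 0, -8, 0, 4], [], 0, 0,
      [0, -24, 0, 8, 0, 24, 0, -8], [-8, 0, -16, 0, -8])"
    by code_simp+
  define K where "K = 8 * (1 + T * T) * m ^ 3"
  have K: "K > 0" using m by (simp add: K_def add_pos_nonneg)
  have "loc T 0 (nodes ! 0) = (K / 2, 0)" "loc T 0 (nodes ! 9) = (- K / 2, 0)"
    by (simp_all add: loc_def n0 n9 K_def m_def algebra_simps power3_eq_cube)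
  then have d: "edist (loc T 0 (nodes ! 9)) (loc T 0 (nodes ! 0)) = K"
    using K by (simp add: edist_def)
  then show "0 < edist (loc (tan t) 0 (nodes ! 9)) (loc (tan t) 0 (nodes ! 0))"
    using K by (simp add: T_def)
  have cT: "(1 + T * T) * (cos t)\<^sup>2 = 1"
    using c sin_cos_squared_add[of t]
    by (simp add: T_def tan_def field_simps power2_eq_square)
  have c0: "cos t \<noteq> 0" using c by simp
  have "ptrig 2 = ([0, 2], [1, 0, -1])" "ptrig 3 = ([0, 3, 0, -1], [1, 0, -3])" by code_simp+
  from this[THEN ptrig[OF c0]]
  have c2: "cos (2 * t) = cos t ^ 2 * m" and s3: "sin (3 * t) = cos t ^ 3 * (T * (3 - T * T))"
    by (simp_all add: m_def T_def algebra_simps)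
  define R q where "R = T * (3 - T * T)" and "q = 1 + T * T"
  have e: "cos t ^ 3 + cos t * (cos t ^ 2 * m) * (cos t ^ 3 * R) = cos t ^ 3 * (1 + m * R * cos t ^ 3)"
      "(cos t ^ 2 * m) ^ 3 = cos t ^ 3 * (cos t ^ 3 * m ^ 3)" by algebra+
  have "lower_bound_L (4 * t) = (1 + m * R * cos t ^ 3) / (cos t ^ 3 * m ^ 3)"
    unfolding lower_bound_L_alt c2 s3 R_def[symmetric] e
    by (rule mult_divide_mult_cancel_left) (use c0 in simp)
  then have L: "lower_bound_L (4 * t) * m ^ 3 = 1 / cos t ^ 3 + m * R"
    using c m by (simp add: field_simps)
  have "q = 1 / (cos t)\<^sup>2" using cT c by (simp add: q_def field_simps)
  then have q: "q\<^sup>2 / cos t = q * (1 / cos t ^ 3)"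
    by (simp add: power2_eq_square power3_eq_cube)
  have "pot t (nodes ! 0) - pot t (nodes ! 9) = 16 * q * (m * R) + 16 * (q\<^sup>2 / cos t)"
    by (simp add: pot_def n0 n9 m_def q_def R_def T_def algebra_simps power2_eq_square
        add_divide_distrib diff_divide_distrib)
  also have "\<dots> = 16 * q * (lower_bound_L (4 * t) * m ^ 3)"
    unfolding q L by (simp add: algebra_simps)
  also have "\<dots> = 2 * lower_bound_L (4 * t) * K" by (simp add: K_def q_def)
  finally show "pot t (nodes ! 0) - pot t (nodes ! 9) =
      2 * lower_bound_L (4 * t) * edist (loc (tan t) 0 (nodes ! 9)) (loc (tan t) 0 (nodes ! 0))"
    unfolding T_def[symmetric] d .
qed

theorem mainTheorem15:
  fixes k :: nat and \<epsilon> :: real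
  assumes "k \<ge> 1" and "\<epsilon> > 0"
  shows "\<exists>P u w. finite P \<and> general_position (4 * k + 3) P \<and> u \<in> P \<and> w \<in> P \<and> u \<noteq> w \<and>
           (\<forall>ps. theta_path (4 * k + 3) P ps u w \<longrightarrow>
              path_length ps \<ge> (lower_bound_L (cone_angle (4 * k + 3)) - \<epsilon>) * edist u w)"
proof -
  define m where "m = 4 * k + 3"
  define t where "t = pi / (2 * real m)"
  have m: "m \<ge> 7" using assms(1) by (simp add: m_def)
  then have "0 < t" by (simp add: t_def)
  moreover have "t \<le> pi / 14" unfolding t_def by (rule frac_le) (use m in auto)
  ultimately have T: "cos t > 0" "0 < tan t" "tan t \<le> 4/17"
    using tan_quarter_bounds by blast+
  define X where "X = (\<lambda>\<delta> v. loc (tan t) \<delta> (nodes ! v))"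
  define f where "f = (\<lambda>v. pot t (nodes ! v))"
  define L where "L = lower_bound_L (cone_angle m)"
  have L: "L = lower_bound_L (4 * t)" using m by (simp add: L_def cone_angle_def t_def)
  \<comment> \<open>Chosen so that \<open>L - \<epsilon> < L / (1 + \<eta>)\<close>, whatever the
    sign of \<open>L\<close>.\<close>
  define \<eta> where "\<eta> = \<epsilon> / (2 * (\<bar>L\<bar> + 1))"
  have \<eta>: "\<eta> > 0" using assms(2) by (simp add: \<eta>_def)
  have "\<exists>g. (\<forall>v<18. near \<delta> (g v) (X \<delta> v)) \<and> inj_on g {..<18} \<and> general_position m (g ` {..<18})"
    if "\<delta> > 0" for \<delta>
    using exists_perturbation[of "\<delta>\<^sup>2" m 18 "X \<delta>"] that m by (simp add: near_def)
  then obtain g where g: "\<And>\<delta> v. \<delta> > 0 \<Longrightarrow> v < 18 \<Longrightarrow> near \<delta> (g \<delta> v) (X \<delta> v)"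
    "\<And>\<delta>. \<delta> > 0 \<Longrightarrow> inj_on (g \<delta>) {..<18}"
    "\<And>\<delta>. \<delta> > 0 \<Longrightarrow> general_position m (g \<delta> ` {..<18})"
    by metis
  define P where "P = (\<lambda>\<delta>. g \<delta> ` {..<18})"
  have pos: "\<forall>\<^sub>F \<delta> in at_right 0. (0::real) < \<delta>" by (simp add: eventually_at_right_less)
  have near: "\<forall>\<^sub>F \<delta> in at_right 0. near \<delta> (g \<delta> v) (loc (tan t) \<delta> (nodes ! v))" if "v < 18" for v
    using pos g(1)[OF _ that] by (auto simp: X_def elim: eventually_mono)
  define good where "good = (\<lambda>\<delta> u v. theta_adj m (P \<delta>) (g \<delta> u) (g \<delta> v) \<longrightarrow>
    \<bar>f u - f v\<bar> \<le> 2 * (1 + \<eta>) * edist (g \<delta> u) (g \<delta> v))"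
  have checked: "case map_of certs (u, v) of
       None \<Rightarrow> far (nodes ! u) (nodes ! v)
     | Some (c, z, c', z') \<Rightarrow> z < 18 \<and> z' < 18 \<and>
         blocks c (nodes ! z) (nodes ! u) (nodes ! v) \<and>
         blocks c' (nodes ! z') (nodes ! v) (nodes ! u)" if "u < 18" "v < u" for u v
    using nodes_checked that unfolding list_all_iff set_upt by (meson atLeastLessThan_iff le0)
  have good: "\<forall>\<^sub>F \<delta> in at_right 0. good \<delta> u v" if uv: "u < 18" "v < u" for u v
  proof (cases "map_of certs (u, v)")
    case None
    then have "far (nodes ! u) (nodes ! v)" using checked[OF uv] by simp
    from far_eventually[OF T(2,3,1) this \<eta> near near]
    show ?thesis using uv unfolding good_def f_def by (auto elim: eventually_mono)
  next
    case (Some a)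
    obtain q j z q' j' z' where a: "a = ((q, j), z, (q', j'), z')" by (metis surj_pair)
    have bl: "blocks (q, j) (nodes ! z) (nodes ! u) (nodes ! v)"
      "blocks (q', j') (nodes ! z') (nodes ! v) (nodes ! u)" "z < 18" "z' < 18"
      using checked[OF uv] unfolding Some a by simp_all
    have zP: "\<forall>\<^sub>F \<delta> in at_right 0. g \<delta> z \<in> P \<delta>" if "z < 18" for z using that by (simp add: P_def)
    have v: "v < 18" using uv by simp
    note bev = blocks_eventually[OF m_def t_def T(2,3,1)]
    have "\<forall>\<^sub>F \<delta> in at_right 0. \<not> theta_edge m (P \<delta>) (g \<delta> u) (g \<delta> v)"
      "\<forall>\<^sub>F \<delta> in at_right 0. \<not> theta_edge m (P \<delta>) (g \<delta> v) (g \<delta> u)"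
      using bev[OF bl(1) near near near zP assms(1)] bev[OF bl(2) near near near zP assms(1)]
        uv v bl(3,4) by simp_all
    then show ?thesis by eventually_elim (simp add: good_def theta_adj_def)
  qed
  have all_good: "\<forall>\<^sub>F \<delta> in at_right 0. \<forall>u\<in>{..<18}. \<forall>v\<in>{..<u}. good \<delta> u v"
    using good by (simp add: eventually_ball_finite)
  define D where "D = edist (X 0 9) (X 0 0)"
  have D: "0 < D" "f 0 - f 9 = 2 * L * D"
    using pot_span[OF T(1,2)] T(3) by (simp_all add: D_def X_def f_def L)
  have "((\<lambda>\<delta>. (L - \<epsilon>) * edist (g \<delta> 9) (g \<delta> 0)) \<longlongrightarrow> (L - \<epsilon>) * D) (at_right 0)"
    unfolding D_def X_def
    by (rule tendsto_mult[OF tendsto_const near_edist_tendsto[OF near near]]) simp_all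
  moreover have "(L - \<epsilon>) * D < L * D / (1 + \<eta>)"
  proof -
    have "L * \<eta> \<le> \<bar>L\<bar> * \<eta>" using \<eta> by (intro mult_right_mono) auto
    also have "\<dots> < \<epsilon>" using assms(2) by (simp add: \<eta>_def field_simps add_nonneg_pos)
    finally have "L * \<eta> < \<epsilon> * (1 + \<eta>)" using mult_pos_pos[OF assms(2) \<eta>] unfolding distrib_left by linarith
    then have "(L - \<epsilon>) * (1 + \<eta>) < L" by (simp add: algebra_simps)
    then have "L - \<epsilon> < L / (1 + \<eta>)" using \<eta> by (simp add: pos_less_divide_eq)
    then have "(L - \<epsilon>) * D < L / (1 + \<eta>) * D" using D(1) by (rule mult_strict_right_mono)
    then show ?thesis by simp
  qed
  ultimately have "\<forall>\<^sub>F \<delta> in at_right 0. (L - \<epsilon>) * edist (g \<delta> 9) (g \<delta> 0) < L * D / (1 + \<eta>)"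
    by (rule order_tendstoD(2))
  with all_good pos have "\<forall>\<^sub>F \<delta> in at_right 0. 0 < \<delta> \<and> (\<forall>u\<in>{..<18}. \<forall>v\<in>{..<u}. good \<delta> u v) \<and>
      (L - \<epsilon>) * edist (g \<delta> 9) (g \<delta> 0) < L * D / (1 + \<eta>)"
    by eventually_elim blast
  then obtain \<delta> where \<delta>: "0 < \<delta>" "\<And>u v. u < 18 \<Longrightarrow> v < u \<Longrightarrow> good \<delta> u v"
    "(L - \<epsilon>) * edist (g \<delta> 9) (g \<delta> 0) < L * D / (1 + \<eta>)"
    using eventually_happens'[OF trivial_limit_at_right_real] by fastforce
  note inj = g(2)[OF \<delta>(1)]
  \<comment> \<open>Injectivity lets the potential of the nodes be read as a function of the
    perturbed points.\<close>
  define F where "F = (\<lambda>p. f (the_inv_into {..<18} (g \<delta>) p))"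
  have F: "F (g \<delta> v) = f v" if "v < 18" for v
    using the_inv_into_f_f[OF inj] that by (simp add: F_def)
  have sym: "edist p q = edist q p" "theta_adj m S p q \<longleftrightarrow> theta_adj m S q p" for p q S
    by (auto simp: edist_def theta_adj_def power2_commute)
  have step: "\<bar>F x - F y\<bar> \<le> 2 * (1 + \<eta>) * edist x y"
    if xy: "x \<in> P \<delta>" "y \<in> P \<delta>" "theta_adj m (P \<delta>) x y" for x y
  proof -
    obtain u v where uv: "u < 18" "v < 18" "x = g \<delta> u" "y = g \<delta> v" using xy by (auto simp: P_def)
    consider "v < u" | "u < v" | "u = v" by linarith
    then show ?thesis
    proof cases
      case 1
      then show ?thesis using \<delta>(2)[of u v] xy uv F by (simp add: good_def)
    next
      case 2
      then show ?thesis using \<delta>(2)[of v u] xy uv F sym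
        by (simp add: good_def abs_minus_commute)
    next
      case 3
      then show ?thesis using uv by (simp add: edist_def)
    qed
  qed
  have "(L - \<epsilon>) * edist (g \<delta> 9) (g \<delta> 0) \<le> path_length ps"
    if "theta_path m (P \<delta>) ps (g \<delta> 9) (g \<delta> 0)" for ps
  proof -
    have "F (g \<delta> 0) - F (g \<delta> 9) \<le> 2 * (1 + \<eta>) * path_length ps"
      by (rule path_length_ge_potential[OF that step])
    moreover have "F (g \<delta> 0) - F (g \<delta> 9) = 2 * L * D" using D(2) F by simp
    ultimately have "L * D \<le> (1 + \<eta>) * path_length ps" by linarith
    then have "L * D / (1 + \<eta>) \<le> path_length ps" using \<eta> by (simp add: pos_divide_le_eq mult.commute)
    then show ?thesis using \<delta>(3) by linarith
  qed
  moreover have "g \<delta> 9 \<noteq> g \<delta> 0" using inj_on_eq_iff[OF inj, of 9 0] by simp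
  moreover have "finite (P \<delta>)" "g \<delta> 9 \<in> P \<delta>" "g \<delta> 0 \<in> P \<delta>" by (auto simp: P_def)
  moreover have "general_position m (P \<delta>)" using g(3)[OF \<delta>(1)] by (simp add: P_def)
  ultimately show ?thesis unfolding L_def m_def by blast
qed

end
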